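(* Let $n\ge 1$ and let $I = I(C_{2n+1})\subseteq K[x_1,\ldots,x_{2n+1}]$ be the edge ideal of the odd cycle $C_{2n+1}$. Then $\operatorname{sdefect}(I,n+1) = 1$. In particular, $I^{(n+1)} = I^{n+1} + (x_1x_2\cdots x_{2n+1})$.
   Context: $K$ is an algebraically closed field. $C_{2n+1}$ is the cycle graph with vertices $x_1,\ldots,x_{2n+1}$ and edges $\{x_j,x_{j+1}\}$ for $1\le j\le 2n$ and $\{x_{2n+1},x_1\}$. The edge ideal $I(G)$ of a simple graph $G$ on the variables is the ideal generated by all products $x_ix_j$ with $\{x_i,x_j\}$ an edge of $G$. The $m$th symbolic power of an ideal $I$ of a polynomial ring $S$ is $I^{(m)} = S\cap\bigcap_{P\in \mathrm{Ass}(I)} I^m S_P$. The symbolic defect $\operatorname{sdefect}(I,m)$ of a homogeneous ideal $I$ is the number of minimal generators of the $S$-module $I^{(m)}/I^m$, i.e. the minimal number $\mu$ of elements $F_1,\ldots,F_\mu$ such that $I^{(m)} = I^m + (F_1,\ldots,F_\mu)$. *)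

theory Defs
  imports
    "HOL-Library.Poly_Mapping"
    "HOL-Computational_Algebra.Polynomial"
    "HOL-Computational_Algebra.Fraction_Field"
    "HOL-Algebra.Ideal_Product"
begin

section \<open>Polynomial rings\<close>

text \<open>
  Monomials are finitely supported exponent vectors indexed by \<^typ>\<open>nat\<close>, and polynomials are
  finitely supported families of coefficients indexed by monomials; the multiplication that
  \<^theory>\<open>HOL-Library.Poly_Mapping\<close> provides on this type is the usual one (convolution).
  The type contains polynomials in all variables \<open>x\<^sub>0, x\<^sub>1, x\<^sub>2, \<dots>\<close>;
  a polynomial ring in a given set of variables is cut out by its carrier.
\<close>

type_synonym 'k mpoly = "(nat \<Rightarrow>\<^sub>0 nat) \<Rightarrow>\<^sub>0 'k"

definition var :: "nat \<Rightarrow> 'k::comm_ring_1 mpoly" where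
  "var i = Poly_Mapping.single (Poly_Mapping.single i 1) 1"

definition vars :: "'k::zero mpoly \<Rightarrow> nat set" where
  "vars p = (\<Union>m\<in>Poly_Mapping.keys p. Poly_Mapping.keys m)"

text \<open>The set \<open>A\<close>, meant to be a subring, with the operations of the ambient type.\<close>

definition ring_on :: "'r::comm_ring_1 set \<Rightarrow> 'r ring" where
  "ring_on A = \<lparr>carrier = A, mult = (*), one = 1, zero = 0, add = (+)\<rparr>"

definition poly_ring :: "nat set \<Rightarrow> 'k::comm_ring_1 mpoly ring" where
  "poly_ring V = ring_on {p. vars p \<subseteq> V}"


section \<open>Symbolic powers and symbolic defect\<close>

abbreviation ideal_power :: "('r, 'b) ring_scheme \<Rightarrow> 'r set \<Rightarrow> nat \<Rightarrow> 'r set" where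
  "ideal_power R I m \<equiv> I [^]\<^bsub>ideals_set R\<^esub> m"

text \<open>
  The associated primes of the module \<open>R/I\<close>: the annihilator of the residue class
  of \<open>a\<close> is \<open>{r. r a \<in> I}\<close>.
\<close>

definition associated_primes :: "('r, 'b) ring_scheme \<Rightarrow> 'r set \<Rightarrow> 'r set set" where
  "associated_primes R I =
    {P. primeideal P R \<and> (\<exists>a\<in>carrier R. P = {r \<in> carrier R. r \<otimes>\<^bsub>R\<^esub> a \<in> I})}"

text \<open>
  In the next definitions \<open>R\<close> is of the form \<^term>\<open>ring_on A\<close> for a subring \<open>A\<close> of an
  integral domain. The localizations of \<open>R\<close> at its prime ideals are
  regarded as subrings of the fraction field, with \<open>f \<in> R\<close> identified with
  \<^term>\<open>Fract f 1\<close>. (The fraction field of the whole type contains that of \<open>R\<close>.)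
\<close>

definition localization :: "'r::idom ring \<Rightarrow> 'r set \<Rightarrow> 'r fract ring" where
  "localization R P = ring_on {Fract a s | a s. a \<in> carrier R \<and> s \<in> carrier R - P}"

definition extended_ideal :: "'r::idom ring \<Rightarrow> 'r set \<Rightarrow> 'r set \<Rightarrow> 'r fract set" where
  "extended_ideal R P J = Idl\<^bsub>localization R P\<^esub> ((\<lambda>f. Fract f 1) ` J)"

definition symbolic_power :: "'r::idom ring \<Rightarrow> 'r set \<Rightarrow> nat \<Rightarrow> 'r set" where
  "symbolic_power R I m =
    carrier R \<inter> (\<Inter>P\<in>associated_primes R I. {f. Fract f 1 \<in> extended_ideal R P (ideal_power R I m)})"

text \<open>
  The ideal sum forces the \<open>F\<^sub>i\<close> to lie in the symbolic power. Some such list exists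
  whenever \<open>R\<close> is Noetherian; otherwise \<^const>\<open>Least\<close> may be unspecified.
\<close>

definition sdefect :: "'r::idom ring \<Rightarrow> 'r set \<Rightarrow> nat \<Rightarrow> nat" where
  "sdefect R I m = (LEAST \<mu>. \<exists>Fs. length Fs = \<mu> \<and> set Fs \<subseteq> carrier R \<and>
    symbolic_power R I m = ideal_power R I m <+>\<^bsub>R\<^esub> Idl\<^bsub>R\<^esub> (set Fs))"


section \<open>Edge ideals\<close>

text \<open>A simple graph is given by its vertex set \<open>V\<close> and a set \<open>E\<close> of two-element subsets of \<open>V\<close>.\<close>

definition edge_ideal :: "nat set \<Rightarrow> nat set set \<Rightarrow> 'k::comm_ring_1 mpoly set" where
  "edge_ideal V E = Idl\<^bsub>poly_ring V\<^esub> {var i * var j | i j. {i, j} \<in> E}"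

text \<open>The edges of the cycle on the vertices \<open>1, \<dots>, N\<close>, for \<open>N \<ge> 3\<close>.\<close>

definition cycle_edges :: "nat \<Rightarrow> nat set set" where
  "cycle_edges N = {{j, j + 1} | j. 1 \<le> j \<and> j < N} \<union> {{N, 1}}"

end

theory Submission
  imports Defs
begin

text \<open>
  The associated primes of an edge ideal \<open>I\<close> are generated by the variables of the minimal vertex
  covers \<open>W\<close>, so the \<open>k\<close>-th symbolic power is the monomial ideal of all exponent vectors of total weight
  at least \<open>k\<close> on each \<open>W\<close>. Covers of the cycle with \<open>2n + 1\<close> vertices have at least \<open>n + 1\<close>
  elements, which puts the product of the variables into the symbolic power for \<open>k = n + 1\<close>; its
  degree \<open>2n + 1\<close> is too small for the ordinary power. A monomial in the symbolic power that is not
  divisible by this product misses a variable and lives on a path, where the weighted Koenig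
  theorem makes it divisible by a product of \<open>n + 1\<close> edges.
\<close>

section \<open>Subrings of integral domains and their localizations\<close>

lemma ring_on_simps [simp]:
  "carrier (ring_on A) = A" "mult (ring_on A) = (*)" "one (ring_on A) = 1"
  "zero (ring_on A) = 0" "add (ring_on A) = (+)"
  by (simp_all add: ring_on_def)

text \<open>Serves twice: for polynomials in finitely or infinitely many chosen variables inside the
  ambient polynomial type, and for localizations inside the fraction field.\<close>

locale unital_subring =
  fixes A :: "'r::comm_ring_1 set"
  assumes one_mem: "1 \<in> A"
    and uminus_mem: "x \<in> A \<Longrightarrow> - x \<in> A"
    and add_mem: "x \<in> A \<Longrightarrow> y \<in> A \<Longrightarrow> x + y \<in> A"
    and mult_mem: "x \<in> A \<Longrightarrow> y \<in> A \<Longrightarrow> x * y \<in> A"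
begin

lemma zero_mem: "0 \<in> A"
  using add_mem[OF one_mem uminus_mem[OF one_mem]] by simp

lemma cring_ring_on: "cring (ring_on A)"
proof (rule cringI)
  show "abelian_group (ring_on A)"
  proof (rule abelian_groupI)
    fix x assume "x \<in> carrier (ring_on A)"
    then show "\<exists>y\<in>carrier (ring_on A). y \<oplus>\<^bsub>ring_on A\<^esub> x = \<zero>\<^bsub>ring_on A\<^esub>"
      by (intro bexI[of _ "- x"]) (auto simp: uminus_mem)
  qed (auto simp: add_mem zero_mem algebra_simps)
  show "comm_monoid (ring_on A)"
    by unfold_locales (auto simp: mult_mem one_mem algebra_simps)
qed (auto simp: algebra_simps)

text \<open>Closure under negation comes from multiplying by \<open>- 1\<close>, which lies in
  \<open>A\<close>. This form avoids the additive subgroup structure in all later ideal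
  proofs.\<close>

lemma ideal_iff:
  "ideal J (ring_on A) \<longleftrightarrow>
    J \<subseteq> A \<and> 0 \<in> J \<and> (\<forall>x\<in>J. \<forall>y\<in>J. x + y \<in> J) \<and> (\<forall>a\<in>A. \<forall>x\<in>J. a * x \<in> J)"
  (is "_ \<longleftrightarrow> ?R")
proof
  assume "ideal J (ring_on A)"
  then interpret ideal J "ring_on A" .
  show ?R
    using a_subset additive_subgroup.zero_closed[OF is_additive_subgroup]
      additive_subgroup.a_closed[OF is_additive_subgroup] I_l_closed by simp
next
  assume R: ?R
  interpret cring "ring_on A" by (rule cring_ring_on)
  show "ideal J (ring_on A)"
  proof (rule idealI)
    show "subgroup J (add_monoid (ring_on A))"
    proof (rule add.subgroupI)
      fix x assume x: "x \<in> J"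
      have "(- 1) * x \<in> J"
        using R x uminus_mem[OF one_mem] by blast
      moreover have "\<ominus>\<^bsub>ring_on A\<^esub> x = - x"
        using R x by (intro minus_equality) (auto simp: uminus_mem)
      ultimately show "\<ominus>\<^bsub>ring_on A\<^esub> x \<in> J"
        by simp
    qed (use R in auto)
    show "a \<otimes>\<^bsub>ring_on A\<^esub> x \<in> J" if "a \<in> J" "x \<in> carrier (ring_on A)" for a x
      using R that by (simp add: mult.commute[of a])
  qed (use R ring_axioms in auto)
qed

end

locale idom_subring = unital_subring A for A :: "'r::idom set"
begin

text \<open>The complement of a prime ideal contains 1, is closed under products and omits 0, so the
  usual common denominator \<open>s * t\<close> is again admissible.\<close>

lemma unital_subring_localization:
  assumes "primeideal P (ring_on A)"
  shows "unital_subring {Fract a s | a s. a \<in> A \<and> s \<in> A - P}"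
proof -
  interpret P: primeideal P "ring_on A" by fact
  have zero_P: "0 \<in> P"
    using additive_subgroup.zero_closed[OF P.is_additive_subgroup] by simp
  have one_P: "1 \<notin> P" using P.one_imp_carrier P.I_notcarr by auto
  have mult_P: "s * t \<in> A - P" if "s \<in> A - P" "t \<in> A - P" for s t
    using that P.I_prime[of s t] mult_mem by auto
  have nz: "s \<noteq> 0" if "s \<in> A - P" for s using that zero_P by auto
  show ?thesis
  proof
    show "1 \<in> {Fract a s | a s. a \<in> A \<and> s \<in> A - P}"
      using one_P one_mem by (auto simp: One_fract_def)
  next
    fix x assume "x \<in> {Fract a s | a s. a \<in> A \<and> s \<in> A - P}"
    then show "- x \<in> {Fract a s | a s. a \<in> A \<and> s \<in> A - P}"
      using uminus_mem by force
  next
    fix x y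
    assume "x \<in> {Fract a s | a s. a \<in> A \<and> s \<in> A - P}"
      and "y \<in> {Fract a s | a s. a \<in> A \<and> s \<in> A - P}"
    then obtain a s b t where xy: "x = Fract a s" "y = Fract b t"
      and m: "a \<in> A" "s \<in> A - P" "b \<in> A" "t \<in> A - P" by blast
    have "x + y = Fract (a * t + b * s) (s * t)" "x * y = Fract (a * b) (s * t)"
      using xy nz m by auto
    then show "x + y \<in> {Fract a s | a s. a \<in> A \<and> s \<in> A - P}"
      and "x * y \<in> {Fract a s | a s. a \<in> A \<and> s \<in> A - P}"
      using m mult_P[OF m(2) m(4)] add_mem mult_mem by blast+
  qed
qed

text \<open>The extension of \<open>J\<close> is contained in the ideal \<open>?T\<close> of
  fractions with numerator in \<open>J\<close>; clearing denominators in
  \<open>Fract f 1 = Fract a s\<close> gives \<open>s * f = a\<close>. This trades localization for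
  a condition inside \<open>A\<close>.\<close>

lemma Fract_in_extended_ideal_iff:
  assumes P: "primeideal P (ring_on A)" and J: "ideal J (ring_on A)" and f: "f \<in> A"
  shows "Fract f 1 \<in> extended_ideal (ring_on A) P J \<longleftrightarrow> (\<exists>s\<in>A - P. s * f \<in> J)"
proof -
  interpret P: primeideal P "ring_on A" by fact
  let ?L = "{Fract a s | a s. a \<in> A \<and> s \<in> A - P}"
  let ?T = "{Fract a s | a s. a \<in> J \<and> s \<in> A - P}"
  interpret L: unital_subring ?L by (rule unital_subring_localization[OF P])
  have loc: "localization (ring_on A) P = ring_on ?L"
    by (simp add: localization_def)
  have zero_P: "0 \<in> P"
    using additive_subgroup.zero_closed[OF P.is_additive_subgroup] by simp
  have one_P: "1 \<in> A - P" using P.one_imp_carrier P.I_notcarr one_mem by auto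
  have mult_P: "s * t \<in> A - P" if "s \<in> A - P" "t \<in> A - P" for s t
    using that P.I_prime[of s t] mult_mem by auto
  have nz: "s \<noteq> 0" if "s \<in> A - P" for s using that zero_P by auto
  have J': "J \<subseteq> A" "0 \<in> J" "\<And>x y. x \<in> J \<Longrightarrow> y \<in> J \<Longrightarrow> x + y \<in> J"
    "\<And>a x. a \<in> A \<Longrightarrow> x \<in> J \<Longrightarrow> a * x \<in> J"
    using J by (auto simp: ideal_iff)
  have "ideal ?T (ring_on ?L)"
    unfolding L.ideal_iff
  proof (intro conjI ballI)
    show "?T \<subseteq> ?L" using J'(1) by blast
    show "0 \<in> ?T" using J'(2) one_P by (auto simp: Zero_fract_def)
  next
    fix x y assume "x \<in> ?T" "y \<in> ?T"
    then obtain a s b t where xy: "x = Fract a s" "y = Fract b t"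
      and m: "a \<in> J" "s \<in> A - P" "b \<in> J" "t \<in> A - P" by blast
    have "x + y = Fract (t * a + s * b) (s * t)"
      using xy nz m by (auto simp: mult.commute)
    then show "x + y \<in> ?T"
      using m mult_P[OF m(2) m(4)] J' by blast
  next
    fix x y assume "x \<in> ?L" "y \<in> ?T"
    then obtain a s b t where xy: "x = Fract a s" "y = Fract b t"
      and m: "a \<in> A" "s \<in> A - P" "b \<in> J" "t \<in> A - P" by blast
    have "x * y = Fract (a * b) (s * t)"
      using xy by auto
    then show "x * y \<in> ?T"
      using m mult_P[OF m(2) m(4)] J' by blast
  qed
  moreover have "(\<lambda>f. Fract f 1) ` J \<subseteq> ?T" using one_P by blast
  ultimately have "extended_ideal (ring_on A) P J \<subseteq> ?T"
    unfolding extended_ideal_def loc genideal_def by blast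
  moreover have "\<exists>s\<in>A - P. s * f \<in> J" if T: "Fract f 1 \<in> ?T"
  proof -
    from T obtain a s where as: "Fract f 1 = Fract a s" "a \<in> J" "s \<in> A - P" by blast
    then have "s * f = a" using nz by (auto simp: eq_fract mult.commute)
    then show ?thesis using as by blast
  qed
  moreover have "Fract f 1 \<in> extended_ideal (ring_on A) P J"
    if s: "s \<in> A - P" and sf: "s * f \<in> J" for s
    unfolding extended_ideal_def loc genideal_def
  proof (clarify)
    fix T assume T: "ideal T (ring_on ?L)" "(\<lambda>f. Fract f 1) ` J \<subseteq> T"
    \<comment> \<open>Since \<open>s\<close> is invertible in the localization, the image of
      \<open>f\<close> is recovered from that of \<open>s * f\<close>.\<close>
    have "Fract 1 s \<in> ?L" using s one_mem by blast
    moreover have "Fract (s * f) 1 \<in> T" using T sf by blast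
    ultimately have "Fract 1 s * Fract (s * f) 1 \<in> T" using T(1) unfolding L.ideal_iff by blast
    moreover have "Fract 1 s * Fract (s * f) 1 = Fract f 1"
      using nz[OF s] by (simp add: eq_fract)
    ultimately show "Fract f 1 \<in> T" by simp
  qed
  ultimately show ?thesis by blast
qed

lemma ideal_ideal_power:
  assumes "ideal J (ring_on A)"
  shows "ideal (ideal_power (ring_on A) J k) (ring_on A)"
proof -
  interpret cring "ring_on A" by (rule cring_ring_on)
  show ?thesis
    by (induction k)
      (auto simp: ideals_set_def nat_pow_def intro: oneideal[simplified] ideal_prod_is_ideal assms)
qed

lemma symbolic_power_iff:
  assumes "ideal J (ring_on A)"
  shows "f \<in> symbolic_power (ring_on A) J k \<longleftrightarrow>
    f \<in> A \<and> (\<forall>P\<in>associated_primes (ring_on A) J. \<exists>s\<in>A - P. s * f \<in> ideal_power (ring_on A) J k)"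
proof -
  have "Fract f 1 \<in> extended_ideal (ring_on A) P (ideal_power (ring_on A) J k) \<longleftrightarrow>
      (\<exists>s\<in>A - P. s * f \<in> ideal_power (ring_on A) J k)"
    if "P \<in> associated_primes (ring_on A) J" "f \<in> A" for P
    using that Fract_in_extended_ideal_iff[OF _ ideal_ideal_power[OF assms]]
    unfolding associated_primes_def by blast
  then show ?thesis
    unfolding symbolic_power_def by auto
qed

end


section \<open>Monomial ideals\<close>

abbreviation monom_of :: "(nat \<Rightarrow>\<^sub>0 nat) \<Rightarrow> 'k::comm_ring_1 mpoly" where
  "monom_of m \<equiv> Poly_Mapping.single m 1"

lemma keys_add_nat: "Poly_Mapping.keys (m + m') = Poly_Mapping.keys m \<union> Poly_Mapping.keys m'"
  for m m' :: "'a \<Rightarrow>\<^sub>0 nat"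
  by (auto simp: in_keys_iff lookup_add)

lemma vars_subset_iff: "vars p \<subseteq> V \<longleftrightarrow> (\<forall>m\<in>Poly_Mapping.keys p. Poly_Mapping.keys m \<subseteq> V)"
  by (auto simp: vars_def)

interpretation polys: idom_subring "{p :: 'k::idom mpoly. vars p \<subseteq> V}" for V
proof
  fix x y :: "'k mpoly"
  assume xy: "x \<in> {p. vars p \<subseteq> V}" "y \<in> {p. vars p \<subseteq> V}"
  then show "x + y \<in> {p. vars p \<subseteq> V}"
    by (auto simp: vars_subset_iff dest!: subsetD[OF keys_add])
  show "x * y \<in> {p. vars p \<subseteq> V}"
    using xy unfolding mem_Collect_eq vars_subset_iff
    by (blast dest: subsetD[OF keys_mult] subsetD[OF equalityD1[OF keys_add_nat]])
qed (auto simp: vars_subset_iff in_keys_iff)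

lemma carrier_poly_ring [simp]: "carrier (poly_ring V) = {p. vars p \<subseteq> V}"
  and mult_poly_ring [simp]: "mult (poly_ring V) = (*)"
  and add_poly_ring [simp]: "add (poly_ring V) = (+)"
  by (simp_all add: poly_ring_def)

lemma cring_poly_ring: "cring (poly_ring V :: 'k::idom mpoly ring)"
  unfolding poly_ring_def by (rule polys.cring_ring_on)

text \<open>This is an ideal only if \<open>M\<close> is stable under adding exponent vectors.
  Arbitrary predicates are allowed so that sets such as the multiples of one monomial by constants
  can also enter product arguments.\<close>

definition monomial_ideal :: "nat set \<Rightarrow> ((nat \<Rightarrow>\<^sub>0 nat) \<Rightarrow> bool) \<Rightarrow> 'k::zero mpoly set" where
  "monomial_ideal V M = {f. vars f \<subseteq> V \<and> (\<forall>m\<in>Poly_Mapping.keys f. M m)}"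

lemma monom_of_in_monomial_ideal:
  "(monom_of m :: 'k::comm_ring_1 mpoly) \<in> monomial_ideal V M \<longleftrightarrow> Poly_Mapping.keys m \<subseteq> V \<and> M m"
  by (simp add: monomial_ideal_def vars_def)

lemma monomial_ideal_mono:
  assumes "\<And>m. Poly_Mapping.keys m \<subseteq> V \<Longrightarrow> M m \<Longrightarrow> M' m"
  shows "monomial_ideal V M \<subseteq> monomial_ideal V M'"
  using assms by (auto simp: monomial_ideal_def vars_subset_iff)

text \<open>Every monomial of a product is a product of monomials of the two factors, whatever
  cancels.\<close>

lemma mult_in_monomial_ideal:
  assumes "f \<in> monomial_ideal V M" "g \<in> monomial_ideal V M'"
    and "\<And>m m'. M m \<Longrightarrow> M' m' \<Longrightarrow> M'' (m + m')"
  shows "f * g \<in> monomial_ideal V M''"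
  using assms unfolding monomial_ideal_def mem_Collect_eq vars_subset_iff
  by (blast dest: subsetD[OF keys_mult] subsetD[OF equalityD1[OF keys_add_nat]])

lemma add_in_monomial_ideal:
  assumes "f \<in> monomial_ideal V M" "g \<in> monomial_ideal V M"
  shows "f + g \<in> monomial_ideal V M"
  using assms keys_add[of f g] unfolding monomial_ideal_def vars_subset_iff by blast

lemma ideal_monomial_ideal:
  assumes "\<And>m m'. M m \<Longrightarrow> M (m' + m)"
  shows "ideal (monomial_ideal V M :: 'k::idom mpoly set) (poly_ring V)"
  unfolding poly_ring_def polys.ideal_iff
proof (intro conjI ballI)
  fix a x :: "'k mpoly" assume "a \<in> {p. vars p \<subseteq> V}" "x \<in> monomial_ideal V M"
  moreover from this have "a \<in> monomial_ideal V (\<lambda>_. True)"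
    by (simp add: monomial_ideal_def)
  ultimately show "a * x \<in> monomial_ideal V M"
    using assms by (blast intro: mult_in_monomial_ideal)
next
  fix x y :: "'k mpoly" assume "x \<in> monomial_ideal V M" "y \<in> monomial_ideal V M"
  then show "x + y \<in> monomial_ideal V M" by (rule add_in_monomial_ideal)
qed (auto simp: monomial_ideal_def vars_def)

lemma sum_singles_eq: "(\<Sum>m\<in>Poly_Mapping.keys f. Poly_Mapping.single m (Poly_Mapping.lookup f m)) = f"
  by (rule poly_mapping_eqI)
    (simp add: lookup_sum lookup_single when_def sum.delta' in_keys_iff)

text \<open>A polynomial is the finite sum of its terms, and each term is a constant times a
  monomial of \<open>J\<close>; hence inclusions need to be tested on monomials only.\<close>

lemma monomial_ideal_subset:
  assumes J: "ideal J (poly_ring V :: 'k::idom mpoly ring)"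
    and M: "\<And>m. Poly_Mapping.keys m \<subseteq> V \<Longrightarrow> M m \<Longrightarrow> monom_of m \<in> J"
  shows "monomial_ideal V M \<subseteq> J"
proof
  fix f :: "'k mpoly" assume f: "f \<in> monomial_ideal V M"
  have J': "0 \<in> J" "\<And>x y. x \<in> J \<Longrightarrow> y \<in> J \<Longrightarrow> x + y \<in> J"
    "\<And>a x. vars a \<subseteq> V \<Longrightarrow> x \<in> J \<Longrightarrow> a * x \<in> J"
    using J by (auto simp: poly_ring_def polys.ideal_iff)
  have single: "Poly_Mapping.single m c \<in> J" if "m \<in> Poly_Mapping.keys f" for m c
  proof -
    have "Poly_Mapping.single 0 c * monom_of m \<in> J"
      using f that by (intro J'(3) M) (auto simp: monomial_ideal_def vars_def)
    then show ?thesis by (simp add: mult_single)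
  qed
  have "(\<Sum>m\<in>K. Poly_Mapping.single m (Poly_Mapping.lookup f m)) \<in> J"
    if K: "K \<subseteq> Poly_Mapping.keys f" for K
  proof -
    have "finite K" using K finite_keys by (rule finite_subset)
    then show ?thesis using K
      by (induction K rule: finite_induct) (auto intro: J' single)
  qed
  from this[OF subset_refl] show "f \<in> J" by (simp add: sum_singles_eq)
qed

text \<open>The product of the parts of least weight of \<open>f\<close> and \<open>g\<close> cannot cancel in \<open>f * g\<close>.\<close>

lemma keys_mult_weight_le:
  fixes f g :: "'a::{linorder, ordered_cancel_comm_monoid_add} \<Rightarrow>\<^sub>0 'k::idom" and w :: "'a \<Rightarrow> nat"
  assumes w: "\<And>a b. w (a + b) = w a + w b"
    and m: "m \<in> Poly_Mapping.keys f" and m': "m' \<in> Poly_Mapping.keys g"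
  shows "\<exists>k\<in>Poly_Mapping.keys (f * g). w k \<le> w m + w m'"
proof -
  \<comment> \<open>\<open>low h\<close> is the part of \<open>h\<close> of least weight, an initial
    form for the grading by \<open>w\<close>.\<close>
  define low where "low h = Poly_Mapping.mapp (\<lambda>k c. c when w k = Min (w ` Poly_Mapping.keys h)) h"
    for h :: "'a \<Rightarrow>\<^sub>0 'k"
  have lookup_low: "Poly_Mapping.lookup (low h) k =
      (Poly_Mapping.lookup h k when w k = Min (w ` Poly_Mapping.keys h))" for h k
    by (auto simp: low_def lookup_mapp when_def in_keys_iff)
  have keys_low: "w k = Min (w ` Poly_Mapping.keys h)" if "k \<in> Poly_Mapping.keys (low h)" for h k
    using that by (auto simp: in_keys_iff lookup_low when_def split: if_splits)
  have le: "Min (w ` Poly_Mapping.keys h) \<le> w k" if "k \<in> Poly_Mapping.keys h" for h k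
    using that by simp
  have keys_high: "Min (w ` Poly_Mapping.keys h) < w k" if "k \<in> Poly_Mapping.keys (h - low h)" for h k
  proof -
    have "Poly_Mapping.lookup h k \<noteq> 0" "w k \<noteq> Min (w ` Poly_Mapping.keys h)"
      using that by (auto simp: in_keys_iff lookup_low lookup_minus when_def split: if_splits)
    then show ?thesis using le[of k h] unfolding in_keys_iff by linarith
  qed
  have low_nz: "low h \<noteq> 0" if "h \<noteq> 0" for h
  proof -
    have "Min (w ` Poly_Mapping.keys h) \<in> w ` Poly_Mapping.keys h"
      using that by (intro Min_in) auto
    then obtain k where "k \<in> Poly_Mapping.keys h" "w k = Min (w ` Poly_Mapping.keys h)" by auto
    then have "Poly_Mapping.lookup (low h) k \<noteq> 0" by (simp add: lookup_low in_keys_iff)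
    then show ?thesis by auto
  qed
  have "f \<noteq> 0" "g \<noteq> 0" using m m' by auto
  \<comment> \<open>There are no zero divisors, because the exponents carry a compatible linear
    order and the coefficients form a domain.\<close>
  then have "low f * low g \<noteq> 0" using low_nz by simp
  then obtain k where k: "k \<in> Poly_Mapping.keys (low f * low g)"
    by (metis all_not_in_conv keys_eq_empty)
  let ?d = "Min (w ` Poly_Mapping.keys f)" and ?e = "Min (w ` Poly_Mapping.keys g)"
  have wk: "w k = ?d + ?e"
    using k keys_mult[of "low f" "low g"] keys_low by (auto simp: w)
  \<comment> \<open>The two remaining summands in the decomposition of \<open>f * g\<close> only
    have monomials of weight above \<open>?d + ?e\<close>, so they cannot cancel
    \<open>k\<close>.\<close>
  have "k \<notin> Poly_Mapping.keys (low f * (g - low g))"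
    using keys_mult[of "low f" "g - low g"] keys_low keys_high wk by (fastforce simp: w)
  moreover have "k \<notin> Poly_Mapping.keys ((f - low f) * g)"
  proof
    assume "k \<in> Poly_Mapping.keys ((f - low f) * g)"
    then obtain a b where "k = a + b" "a \<in> Poly_Mapping.keys (f - low f)" "b \<in> Poly_Mapping.keys g"
      using keys_mult[of "f - low f" g] by auto
    moreover from this have "?d < w a" "?e \<le> w b"
      using keys_high le by blast+
    moreover have "w a + w b = ?d + ?e"
      using wk \<open>k = a + b\<close> by (simp only: w)
    ultimately show False by linarith
  qed
  moreover have "f * g = low f * low g + low f * (g - low g) + (f - low f) * g"
    by (simp add: algebra_simps)
  ultimately have "k \<in> Poly_Mapping.keys (f * g)"
    using k by (simp add: in_keys_iff lookup_add)
  then show ?thesis using wk le[OF m] le[OF m'] by (intro bexI[of _ k]) auto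
qed


section \<open>Powers of edge ideals\<close>

text \<open>Divisibility of the monomial \<open>m\<close> by a product of \<open>k\<close> edges,
  repetitions allowed. The base case accepts every \<open>m\<close>, which absorbs the
  cofactor.\<close>

inductive edge_divisible :: "nat set set \<Rightarrow> nat \<Rightarrow> (nat \<Rightarrow>\<^sub>0 nat) \<Rightarrow> bool" for E where
  zero: "edge_divisible E 0 m"
| Suc: "{i, j} \<in> E \<Longrightarrow> edge_divisible E k m \<Longrightarrow>
    edge_divisible E (Suc k) (Poly_Mapping.single i 1 + Poly_Mapping.single j 1 + m)"

lemma edge_divisible_add: "edge_divisible E k m \<Longrightarrow> edge_divisible E k (m' + m)"
proof (induction rule: edge_divisible.induct)
  case (Suc i j k m)
  have "m' + (Poly_Mapping.single i 1 + Poly_Mapping.single j 1 + m) =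
    Poly_Mapping.single i 1 + Poly_Mapping.single j 1 + (m' + m)" by (simp add: ac_simps)
  then show ?case using edge_divisible.Suc[OF Suc.hyps(1) Suc.IH] by metis
qed (rule edge_divisible.zero)

lemma edge_divisible_mult:
  assumes "edge_divisible E k m" "edge_divisible E l m'"
  shows "edge_divisible E (k + l) (m + m')"
  using assms(1)
proof (induction rule: edge_divisible.induct)
  case zero
  then show ?case using assms(2) by (simp add: edge_divisible_add)
next
  case (Suc i j k m)
  then show ?case using edge_divisible.Suc[OF Suc.hyps(1) Suc.IH] by (simp add: add.assoc)
qed

lemma edge_divisible_1_iff:
  "edge_divisible E 1 m \<longleftrightarrow>
    (\<exists>i j m'. {i, j} \<in> E \<and> m = Poly_Mapping.single i 1 + Poly_Mapping.single j 1 + m')"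
  by (auto simp: edge_divisible.simps[of E "Suc 0"] intro: edge_divisible.zero)

lemma ideal_edge_divisible: "ideal (monomial_ideal V (edge_divisible E k) :: 'k::idom mpoly set) (poly_ring V)"
  by (intro ideal_monomial_ideal edge_divisible_add)

lemma monom_of_add: "(monom_of (m + m') :: 'k::comm_ring_1 mpoly) = monom_of m * monom_of m'"
  by (simp add: mult_single)

lemma var_eq_monom_of: "var i = monom_of (Poly_Mapping.single i 1)"
  by (simp add: var_def)

lemma edge_ideal_eq:
  assumes "\<Union>E \<subseteq> V"
  shows "(edge_ideal V E :: 'k::idom mpoly set) = monomial_ideal V (edge_divisible E 1)"
proof -
  let ?G = "{var i * var j | i j. {i, j} \<in> E} :: 'k mpoly set"
  let ?M = "monomial_ideal V (edge_divisible E 1) :: 'k mpoly set"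
  interpret R: cring "poly_ring V :: 'k mpoly ring" by (rule cring_poly_ring)
  have G: "?G \<subseteq> ?M"
  proof clarify
    fix i j assume ij: "{i, j} \<in> E"
    then have "edge_divisible E 1 (Poly_Mapping.single i 1 + Poly_Mapping.single j 1)"
      unfolding edge_divisible_1_iff by (metis add.right_neutral)
    moreover have "i \<in> V" "j \<in> V" using ij assms by auto
    ultimately show "var i * var j \<in> ?M"
      unfolding var_eq_monom_of monom_of_add[symmetric] monom_of_in_monomial_ideal
      by (simp add: keys_add_nat)
  qed
  then have Gc: "?G \<subseteq> carrier (poly_ring V)"
    by (auto simp: monomial_ideal_def)
  note I = R.genideal_ideal[OF Gc]
  have "?M \<subseteq> Idl\<^bsub>poly_ring V\<^esub> ?G"
  proof (rule monomial_ideal_subset[OF I])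
    fix m assume m: "Poly_Mapping.keys m \<subseteq> V" "edge_divisible E 1 m"
    then obtain i j m' where e: "{i, j} \<in> E"
      and m': "m = m' + (Poly_Mapping.single i 1 + Poly_Mapping.single j 1)"
      unfolding edge_divisible_1_iff by (metis add.commute)
    have "monom_of m' \<in> carrier (poly_ring V)"
      using m(1) m' by (simp add: vars_def keys_add_nat)
    moreover have "var i * var j \<in> Idl\<^bsub>poly_ring V\<^esub> ?G"
      using R.genideal_self[OF Gc] e by blast
    ultimately have "monom_of m' * (var i * var j) \<in> Idl\<^bsub>poly_ring V\<^esub> ?G"
      using ideal.I_l_closed[OF I] by simp
    then show "monom_of m \<in> Idl\<^bsub>poly_ring V\<^esub> ?G"
      by (simp add: m' monom_of_add var_eq_monom_of)
  qed
  moreover have "Idl\<^bsub>poly_ring V\<^esub> ?G \<subseteq> ?M"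
    by (rule R.genideal_minimal[OF ideal_edge_divisible G])
  ultimately show ?thesis unfolding edge_ideal_def by blast
qed

text \<open>Products of \<open>k\<close> edges multiply with single edges to products of
  \<open>k + 1\<close> edges, and every such product splits in this way.\<close>

lemma edge_ideal_power_eq:
  assumes "\<Union>E \<subseteq> V"
  shows "ideal_power (poly_ring V) (edge_ideal V E :: 'k::idom mpoly set) k =
    monomial_ideal V (edge_divisible E k)"
proof (induction k)
  case 0
  show ?case
    \<comment> \<open>The zeroth power is the whole ring, and every monomial is divisible by the
      empty product of edges.\<close>
    by (auto simp: nat_pow_def ideals_set_def monomial_ideal_def edge_divisible.zero)
next
  case (Suc k)
  let ?M = "\<lambda>k. monomial_ideal V (edge_divisible E k) :: 'k mpoly set"
  let ?P = "ideal_prod (poly_ring V) (?M k) (?M 1)"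
  interpret R: cring "poly_ring V :: 'k mpoly ring" by (rule cring_poly_ring)
  have "ideal_power (poly_ring V) (edge_ideal V E :: 'k mpoly set) (Suc k) = ?P"
    using Suc by (simp add: nat_pow_def ideals_set_def edge_ideal_eq[OF assms])
  moreover have "?P \<subseteq> ?M (Suc k)"
  proof
    fix f assume "f \<in> ?P"
    then show "f \<in> ?M (Suc k)"
    proof (induction rule: ideal_prod.induct)
      case (prod i j)
      then show ?case
        using edge_divisible_mult[of E k _ 1] by (auto intro: mult_in_monomial_ideal)
    qed (simp add: add_in_monomial_ideal)
  qed
  moreover have "?M (Suc k) \<subseteq> ?P"
  proof (rule monomial_ideal_subset)
    show "ideal ?P (poly_ring V)"
      by (intro R.ideal_prod_is_ideal ideal_edge_divisible)
    fix m assume m: "Poly_Mapping.keys m \<subseteq> V" "edge_divisible E (Suc k) m"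
    \<comment> \<open>One edge is split off; the other \<open>k\<close> edges and the cofactor stay
      together in \<open>m'\<close>.\<close>
    from m(2) obtain i j m' where e: "{i, j} \<in> E" "edge_divisible E k m'"
      and m': "m = m' + (Poly_Mapping.single i 1 + Poly_Mapping.single j 1)"
      by (cases rule: edge_divisible.cases) (auto simp: add.commute)
    have "edge_divisible E 1 (Poly_Mapping.single i 1 + Poly_Mapping.single j 1)"
      using e(1) unfolding edge_divisible_1_iff by (metis add.right_neutral)
    then have "(monom_of m' * monom_of (Poly_Mapping.single i 1 + Poly_Mapping.single j 1) :: 'k mpoly) \<in> ?P"
      using e m(1) m' ideal_prod.prod[of "monom_of m'" "?M k"
          "monom_of (Poly_Mapping.single i 1 + Poly_Mapping.single j 1)" "?M 1" "poly_ring V"]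
      by (simp add: monom_of_in_monomial_ideal keys_add_nat)
    then show "monom_of m \<in> ?P" by (simp add: m' monom_of_add)
  qed
  ultimately show ?case by blast
qed


section \<open>Symbolic powers of edge ideals\<close>

abbreviation weight :: "nat set \<Rightarrow> (nat \<Rightarrow>\<^sub>0 nat) \<Rightarrow> nat" where
  "weight W m \<equiv> \<Sum>i\<in>W. Poly_Mapping.lookup m i"

lemma weight_add: "weight W (m + m') = weight W m + weight W m'"
  by (simp add: lookup_add sum.distrib)

lemma weight_single: "finite W \<Longrightarrow> weight W (Poly_Mapping.single i b) = (if i \<in> W then b else 0)"
  by (simp add: lookup_single when_def)

lemma lookup_sum_singles:
  "finite A \<Longrightarrow> Poly_Mapping.lookup (\<Sum>i\<in>A. Poly_Mapping.single i 1) j = (if j \<in> A then 1 else 0)"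
  by (simp add: lookup_sum lookup_single when_def)

text \<open>Some monomial of \<open>s\<close> has weight 0, so a monomial of \<open>f\<close> of
  weight below \<open>k\<close> would force one of weight below \<open>k\<close> in
  \<open>s * f\<close>. For finite \<open>W \<subseteq> V\<close> this says that the powers of the
  prime generated by the variables in \<open>W\<close> are primary.\<close>

lemma weight_ideal_saturated:
  fixes f s :: "'k::idom mpoly"
  assumes sf: "s * f \<in> monomial_ideal V (\<lambda>m. k \<le> weight W m)"
    and s: "vars s \<subseteq> V" "s \<notin> monomial_ideal V (\<lambda>m. 0 < weight W m)" and f: "vars f \<subseteq> V"
  shows "f \<in> monomial_ideal V (\<lambda>m. k \<le> weight W m)"
proof -
  obtain m' where m': "m' \<in> Poly_Mapping.keys s" "weight W m' = 0"
    using s by (auto simp: monomial_ideal_def)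
  have "k \<le> weight W m" if m: "m \<in> Poly_Mapping.keys f" for m
    using keys_mult_weight_le[of "weight W", OF weight_add m'(1) m] sf m'(2)
    by (fastforce simp: monomial_ideal_def)
  then show ?thesis using f by (simp add: monomial_ideal_def)
qed

lemma keys_monom_of_mult:
  "m \<in> Poly_Mapping.keys f \<Longrightarrow> m' + m \<in> Poly_Mapping.keys (monom_of m' * f)"
  for f :: "'k::comm_ring_1 mpoly"
  by (simp add: in_keys_iff lookup_mult lookup_single when_mult)

section \<open>Vertex covers and the weights of monomials on them\<close>

definition vertex_cover :: "nat set set \<Rightarrow> nat set \<Rightarrow> bool" where
  "vertex_cover E W \<longleftrightarrow> (\<forall>e\<in>E. e \<inter> W \<noteq> {})"

text \<open>Covers are arbitrary sets of numbers; in a graph, minimality confines them to the vertex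
  set.\<close>

definition minimal_cover :: "nat set set \<Rightarrow> nat set \<Rightarrow> bool" where
  "minimal_cover E W \<longleftrightarrow> vertex_cover E W \<and> (\<forall>U. U \<subset> W \<longrightarrow> \<not> vertex_cover E U)"

lemma exists_minimal_cover:
  assumes "finite W" "vertex_cover E W"
  obtains U where "U \<subseteq> W" "minimal_cover E U"
proof -
  have "finite {U. U \<subseteq> W \<and> vertex_cover E U}" using assms(1) by simp
  from finite_has_minimal2[OF this, of W] assms(2)
  obtain U where U: "U \<subseteq> W" "vertex_cover E U"
    "\<And>B. B \<subseteq> W \<Longrightarrow> vertex_cover E B \<Longrightarrow> B \<subseteq> U \<Longrightarrow> U = B" by auto
  then have "minimal_cover E U" unfolding minimal_cover_def by blast
  then show ?thesis using that U(1) by blast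
qed

text \<open>Each of the \<open>k\<close> edges has an end in \<open>W\<close> and so contributes at
  least 1 to the weight.\<close>

lemma edge_divisible_le_weight:
  assumes "edge_divisible E k m" "vertex_cover E W" "finite W"
  shows "k \<le> weight W m"
  using assms(1)
proof (induction rule: edge_divisible.induct)
  case (Suc i j k m)
  then have "i \<in> W \<or> j \<in> W" using assms(2) by (auto simp: vertex_cover_def)
  then show ?case using Suc assms(3) by (auto simp: weight_add weight_single)
qed simp

locale finite_graph =
  fixes V :: "nat set" and E :: "nat set set"
  assumes finite_V: "finite V"
    and edges: "e \<in> E \<Longrightarrow> e \<subseteq> V \<and> card e = 2"
begin

lemma Union_edges: "\<Union>E \<subseteq> V"
  using edges by blast

lemma edgeD: "{i, j} \<in> E \<Longrightarrow> i \<noteq> j \<and> i \<in> V \<and> j \<in> V"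
  using edges[of "{i, j}"] by (auto simp: card_insert_if split: if_splits)

lemma edgeE:
  assumes "e \<in> E" "i \<in> e" obtains j where "e = {i, j}"
  using edges[OF assms(1)] assms(2) by (auto simp: card_2_iff)

lemma minimal_cover_iff:
  "minimal_cover E W \<longleftrightarrow> W \<subseteq> V \<and> vertex_cover E W \<and> (\<forall>i\<in>W. \<exists>j\<in>V - W. {i, j} \<in> E)"
proof
  assume W: "minimal_cover E W"
  have nbr: "\<exists>j\<in>V - W. {i, j} \<in> E" if i: "i \<in> W" for i
  proof -
    have "\<not> vertex_cover E (W - {i})" using W i unfolding minimal_cover_def by blast
    then obtain e where e: "e \<in> E" "e \<inter> (W - {i}) = {}" by (auto simp: vertex_cover_def)
    moreover have "e \<inter> W \<noteq> {}" using W e(1) by (simp add: minimal_cover_def vertex_cover_def)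
    ultimately have "i \<in> e" by blast
    then obtain j where "e = {i, j}" by (rule edgeE[OF e(1)])
    then show ?thesis using e edgeD[of i j] by blast
  qed
  then have "W \<subseteq> V" using edgeD by blast
  then show "W \<subseteq> V \<and> vertex_cover E W \<and> (\<forall>i\<in>W. \<exists>j\<in>V - W. {i, j} \<in> E)"
    using W nbr by (simp add: minimal_cover_def)
next
  assume W: "W \<subseteq> V \<and> vertex_cover E W \<and> (\<forall>i\<in>W. \<exists>j\<in>V - W. {i, j} \<in> E)"
  show "minimal_cover E W"
    unfolding minimal_cover_def
  proof (intro conjI allI impI)
    fix U assume "U \<subset> W"
    then obtain i where i: "i \<in> W" "i \<notin> U" by blast
    then obtain j where "j \<notin> W" "{i, j} \<in> E" using W by blast
    then show "\<not> vertex_cover E U" using \<open>U \<subset> W\<close> i by (fastforce simp: vertex_cover_def)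
  qed (use W in blast)
qed

text \<open>The ends of an edge are distinct, so divisibility by one edge depends only on the
  support of \<open>m\<close>, not on multiplicities.\<close>

lemma edge_divisible_1_iff_keys:
  "edge_divisible E 1 m \<longleftrightarrow> (\<exists>i j. {i, j} \<in> E \<and> {i, j} \<subseteq> Poly_Mapping.keys m)"
proof
  assume "edge_divisible E 1 m"
  then show "\<exists>i j. {i, j} \<in> E \<and> {i, j} \<subseteq> Poly_Mapping.keys m"
    unfolding edge_divisible_1_iff by (force simp: keys_add_nat)
next
  assume "\<exists>i j. {i, j} \<in> E \<and> {i, j} \<subseteq> Poly_Mapping.keys m"
  then obtain i j where e: "{i, j} \<in> E" and k: "{i, j} \<subseteq> Poly_Mapping.keys m" by blast
  let ?e = "Poly_Mapping.single i 1 + Poly_Mapping.single j 1 :: nat \<Rightarrow>\<^sub>0 nat"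
  have "m = ?e + (m - ?e)"
    using edgeD[OF e] k
    by (intro poly_mapping_eqI)
      (auto simp: lookup_add lookup_minus lookup_single when_def in_keys_iff)
  then show "edge_divisible E 1 m" using e unfolding edge_divisible_1_iff by blast
qed

section \<open>Associated primes of an edge ideal\<close>

lemma edge_ideal_ideal: "ideal (edge_ideal V E :: 'k::idom mpoly set) (poly_ring V)"
  unfolding edge_ideal_eq[OF Union_edges] by (rule ideal_edge_divisible)

text \<open>The prime is the annihilator of the product of all variables outside \<open>W\<close>: a
  variable of \<open>W\<close> completes an edge with a neighbour outside \<open>W\<close>, and
  conversely this product has weight 0 on \<open>W\<close> and can be cancelled from weight
  conditions.\<close>

lemma cover_prime_associated:
  assumes W: "minimal_cover E W"
  shows "(monomial_ideal V (\<lambda>m. 0 < weight W m) :: 'k::idom mpoly set)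
    \<in> associated_primes (poly_ring V) (edge_ideal V E)"
proof -
  let ?P = "monomial_ideal V (\<lambda>m. 0 < weight W m) :: 'k mpoly set"
  have P1: "?P = monomial_ideal V (\<lambda>m. 1 \<le> weight W m)" by (simp add: Suc_le_eq)
  have WV: "W \<subseteq> V" using W by (simp add: minimal_cover_iff)
  then have fin: "finite W" using finite_V finite_subset by blast
  \<comment> \<open>Primality is saturation for weight at least 1, which is why \<open>P1\<close>
    rewrites the strict inequality.\<close>
  have "primeideal ?P (poly_ring V)"
  proof (rule primeidealI)
    show "ideal ?P (poly_ring V)"
      by (rule ideal_monomial_ideal) (simp add: weight_add)
    show "cring (poly_ring V :: 'k mpoly ring)" by (rule cring_poly_ring)
    have "(1 :: 'k mpoly) \<notin> ?P" "vars (1 :: 'k mpoly) \<subseteq> V"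
      by (simp_all add: monomial_ideal_def vars_def)
    then show "carrier (poly_ring V) \<noteq> ?P" by auto
    fix a b :: "'k mpoly"
    assume "a \<in> carrier (poly_ring V)" "b \<in> carrier (poly_ring V)" "a \<otimes>\<^bsub>poly_ring V\<^esub> b \<in> ?P"
    then show "a \<in> ?P \<or> b \<in> ?P"
      using weight_ideal_saturated[of a b V 1 W] unfolding P1[symmetric] by auto
  qed
  moreover define c :: "nat \<Rightarrow>\<^sub>0 nat" where "c = (\<Sum>i\<in>V - W. Poly_Mapping.single i 1)"
  have lookup_c: "Poly_Mapping.lookup c i = (if i \<in> V - W then 1 else 0)" for i
    unfolding c_def using finite_V by (intro lookup_sum_singles) simp
  have keys_c: "Poly_Mapping.keys c = V - W" by (auto simp: in_keys_iff lookup_c split: if_splits)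
  then have c_carrier: "vars (monom_of c :: 'k mpoly) \<subseteq> V" by (auto simp: vars_def)
  have "?P = {r \<in> carrier (poly_ring V). r \<otimes>\<^bsub>poly_ring V\<^esub> monom_of c \<in> edge_ideal V E}"
  proof (intro equalityI subsetI)
    fix r assume r: "r \<in> ?P"
    have "monom_of c \<in> monomial_ideal V (\<lambda>m. m = c)"
      using keys_c by (auto simp: monom_of_in_monomial_ideal)
    with r have "r * monom_of c \<in> monomial_ideal V (edge_divisible E 1)"
    proof (rule mult_in_monomial_ideal)
      fix m m' assume m: "0 < weight W m" and m': "m' = c"
      from m obtain i where i: "i \<in> W" "i \<in> Poly_Mapping.keys m"
        unfolding in_keys_iff by (metis less_irrefl sum.neutral)
      then obtain j where j: "j \<in> V - W" "{i, j} \<in> E" using W by (auto simp: minimal_cover_iff)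
      then show "edge_divisible E 1 (m + m')"
        using i unfolding edge_divisible_1_iff_keys by (auto simp: keys_add_nat keys_c m')
    qed
    then show "r \<in> {r \<in> carrier (poly_ring V). r \<otimes>\<^bsub>poly_ring V\<^esub> monom_of c \<in> edge_ideal V E}"
      using r by (simp add: edge_ideal_eq[OF Union_edges] monomial_ideal_def)
  next
    fix r :: "'k mpoly"
    assume "r \<in> {r \<in> carrier (poly_ring V). r \<otimes>\<^bsub>poly_ring V\<^esub> monom_of c \<in> edge_ideal V E}"
    then have r: "vars r \<subseteq> V" and "monom_of c * r \<in> monomial_ideal V (edge_divisible E 1)"
      by (simp_all add: edge_ideal_eq[OF Union_edges] mult.commute)
    moreover have "vertex_cover E W" using W by (simp add: minimal_cover_def)
    ultimately have "monom_of c * r \<in> monomial_ideal V (\<lambda>m. 1 \<le> weight W m)"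
      using edge_divisible_le_weight[OF _ _ fin]
      by (blast intro: subsetD[OF monomial_ideal_mono])
    moreover have "(monom_of c :: 'k mpoly) \<notin> ?P"
      by (simp add: monom_of_in_monomial_ideal lookup_c)
    ultimately show "r \<in> ?P"
      using weight_ideal_saturated[OF _ c_carrier _ r, of 1 W] unfolding P1[symmetric] by blast
  qed
  ultimately show ?thesis using c_carrier unfolding associated_primes_def by auto
qed

text \<open>Primality puts an end of every edge into \<open>P\<close>. If all neighbours of some
  \<open>i\<close> in this cover were in it too, the products of \<open>a\<close> with the variables
  of \<open>i\<close> and its neighbours would lie in the edge ideal, forcing \<open>a\<close>
  itself into it.\<close>

lemma associated_prime_minimal_cover:
  fixes P :: "'k::idom mpoly set"
  assumes P: "P \<in> associated_primes (poly_ring V) (edge_ideal V E)"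
  shows "minimal_cover E {i \<in> V. var i \<in> P}"
proof -
  let ?W = "{i \<in> V. var i \<in> P}"
  obtain a where prime: "primeideal P (poly_ring V)" and a: "vars a \<subseteq> V"
    and P_eq: "P = {r. vars r \<subseteq> V \<and> r * a \<in> edge_ideal V E}"
    using P by (auto simp: associated_primes_def)
  interpret P: primeideal P "poly_ring V" by fact
  have var_V: "vars (var i :: 'k mpoly) \<subseteq> V" if "i \<in> V" for i
    using that by (simp add: var_def vars_def)
  have a_notin: "a \<notin> edge_ideal V E"
  proof
    assume "a \<in> edge_ideal V E"
    then have "1 \<in> P" by (simp add: P_eq vars_def)
    then have "P = carrier (poly_ring V)"
      by (intro P.one_imp_carrier) (simp add: poly_ring_def)
    then show False using P.I_notcarr by simp
  qed
  have "vertex_cover E ?W"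
    unfolding vertex_cover_def
  proof
    fix e assume e: "e \<in> E"
    then obtain i j where ij: "e = {i, j}" using edges by (meson card_2_iff)
    then have V: "i \<in> V" "j \<in> V" using edgeD e by auto
    have "(var i * var j :: 'k mpoly) \<in> monomial_ideal V (edge_divisible E 1)"
      using V e ij unfolding var_eq_monom_of monom_of_add[symmetric] monom_of_in_monomial_ideal
        edge_divisible_1_iff_keys by (auto simp: keys_add_nat)
    then have "(var i * var j :: 'k mpoly) \<in> edge_ideal V E"
      by (simp add: edge_ideal_eq[OF Union_edges])
    from ideal.I_r_closed[OF edge_ideal_ideal this] a
    have "var i * var j * a \<in> edge_ideal V E" by simp
    moreover have "vars (var i * var j :: 'k mpoly) \<subseteq> V"
      using polys.mult_mem[of "var i" V "var j"] var_V V by auto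
    ultimately have "var i * var j \<in> P" by (simp add: P_eq)
    then have "var i \<in> P \<or> var j \<in> P"
      using P.I_prime[of "var i" "var j"] var_V V by simp
    then show "e \<inter> ?W \<noteq> {}" using V ij by auto
  qed
  moreover have "\<exists>j\<in>V - ?W. {i, j} \<in> E" if i: "i \<in> ?W" for i
  proof (rule ccontr)
    assume "\<not> (\<exists>j\<in>V - ?W. {i, j} \<in> E)"
    then have nbr: "j \<in> ?W" if "{i, j} \<in> E" for j using that edgeD by blast
    \<comment> \<open>Multiplication by a variable shifts the monomials of \<open>a\<close> without
      cancellation, so each shifted monomial is divisible by an edge.\<close>
    have div: "edge_divisible E 1 (Poly_Mapping.single j 1 + m)"
      if j: "j \<in> ?W" and m: "m \<in> Poly_Mapping.keys a" for j m
    proof -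
      have "var j * a \<in> edge_ideal V E" using j by (simp add: P_eq)
      then show ?thesis
        using keys_monom_of_mult[OF m, of "Poly_Mapping.single j 1"]
        by (simp add: edge_ideal_eq[OF Union_edges] monomial_ideal_def var_def)
    qed
    have "edge_divisible E 1 m" if m: "m \<in> Poly_Mapping.keys a" for m
    proof (cases "\<exists>j\<in>Poly_Mapping.keys m. {i, j} \<in> E")
      case True
      then obtain j where j: "j \<in> Poly_Mapping.keys m" "{i, j} \<in> E" by blast
      \<comment> \<open>As \<open>m\<close> already contains \<open>j\<close>, multiplying by that
        variable leaves the support unchanged.\<close>
      then show ?thesis
        using div[OF nbr[OF j(2)] m] unfolding edge_divisible_1_iff_keys
        by (simp add: keys_add_nat insert_absorb)
    next
      case False
      \<comment> \<open>An edge in the support enlarged by \<open>i\<close> cannot end in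
        \<open>i\<close>, since no neighbour of \<open>i\<close> occurs; hence it lies in the
        support of \<open>m\<close>.\<close>
      obtain u v where uv: "{u, v} \<in> E" "{u, v} \<subseteq> insert i (Poly_Mapping.keys m)"
        using div[OF i m] unfolding edge_divisible_1_iff_keys by (auto simp: keys_add_nat)
      have "u \<noteq> i" "v \<noteq> i"
        using uv edgeD[OF uv(1)] False by (auto simp: insert_commute)
      then show ?thesis using uv unfolding edge_divisible_1_iff_keys by blast
    qed
    then show False using a a_notin by (simp add: edge_ideal_eq[OF Union_edges] monomial_ideal_def)
  qed
  ultimately show ?thesis by (auto simp: minimal_cover_iff)
qed

text \<open>Supplies a monomial denominator outside \<open>P\<close>: each unit of weight at a cover
  vertex becomes an edge after multiplication by a neighbouring variable outside \<open>P\<close>.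
  Finitely many monomials are served at once by multiplying their denominators.\<close>

lemma associated_prime_multiplier:
  fixes P :: "'k::idom mpoly set"
  assumes P: "P \<in> associated_primes (poly_ring V) (edge_ideal V E)"
    and K: "finite K" "\<And>m. m \<in> K \<Longrightarrow> k \<le> weight {i \<in> V. var i \<in> P} m"
  shows "\<exists>t. Poly_Mapping.keys t \<subseteq> V \<and> monom_of t \<notin> P \<and> (\<forall>m\<in>K. edge_divisible E k (t + m))"
proof -
  let ?W = "{i \<in> V. var i \<in> P}"
  let ?Q = "\<lambda>t. Poly_Mapping.keys t \<subseteq> V \<and> monom_of t \<notin> P"
  interpret P: primeideal P "poly_ring V" using P by (simp add: associated_primes_def)
  have fin: "finite ?W" using finite_V by simp
  have Q_add: "?Q (t + t')" if "?Q t" "?Q t'" for t t'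
    using that P.I_prime[of "monom_of t" "monom_of t'"]
    by (auto simp: keys_add_nat mult_single vars_def)
  have Q_0: "?Q 0"
    using P.one_imp_carrier P.I_notcarr by (auto simp: poly_ring_def)
  have single: "\<exists>t. ?Q t \<and> edge_divisible E k (t + m)" if "k \<le> weight ?W m" for k m
    using that
  proof (induction k arbitrary: m)
    case 0
    then show ?case using Q_0 by (blast intro: edge_divisible.zero)
  next
    case (Suc k)
    then have "weight ?W m \<noteq> 0" by linarith
    then obtain i where i: "i \<in> ?W" "Poly_Mapping.lookup m i \<noteq> 0"
      by (meson sum.neutral)
    \<comment> \<open>One factor at the cover vertex \<open>i\<close> is removed, to be paired with
      its neighbour \<open>j\<close> outside the cover.\<close>
    define m' where "m' = m - Poly_Mapping.single i 1"
    have m: "m = m' + Poly_Mapping.single i 1"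
      using i(2) by (intro poly_mapping_eqI)
        (auto simp: m'_def lookup_add lookup_minus lookup_single when_def)
    have "k \<le> weight ?W m'"
      using Suc.prems i(1) fin unfolding m weight_add by (simp add: weight_single)
    then obtain t where t: "?Q t" "edge_divisible E k (t + m')" using Suc.IH by blast
    obtain j where j: "j \<in> V - ?W" "{i, j} \<in> E"
      using associated_prime_minimal_cover[OF P] i(1) by (auto simp: minimal_cover_iff)
    have "Poly_Mapping.single i 1 + Poly_Mapping.single j 1 + (t + m') = Poly_Mapping.single j 1 + t + m"
      by (simp add: m ac_simps)
    then have "edge_divisible E (Suc k) (Poly_Mapping.single j 1 + t + m)"
      using edge_divisible.Suc[OF j(2) t(2)] by simp
    moreover have "?Q (Poly_Mapping.single j 1)" using j by (auto simp: var_def)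
    ultimately show ?case using Q_add t(1) by blast
  qed
  show ?thesis
    using K
  proof (induction K rule: finite_induct)
    case empty
    then show ?case using Q_0 by blast
  next
    case (insert m K)
    then obtain t where t: "?Q t" "\<forall>m\<in>K. edge_divisible E k (t + m)" by blast
    obtain t' where t': "?Q t'" "edge_divisible E k (t' + m)" using single insert.prems by blast
    have "edge_divisible E k (t' + t + m')" if "m' \<in> insert m K" for m'
      using that t(2) t'(2) edge_divisible_add[of E k "t + m'" t'] edge_divisible_add[of E k "t' + m'" t]
      by (auto simp: ac_simps)
    then show ?case using Q_add t(1) t'(1) by blast
  qed
qed

text \<open>Localizing at the prime of a minimal cover yields its weight bound, as the denominator
  can be cancelled by saturation. Conversely, the bound for the cover belonging to an associated
  prime yields a monomial denominator outside that prime.\<close>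

lemma symbolic_power_edge_ideal:
  "symbolic_power (poly_ring V) (edge_ideal V E :: 'k::idom mpoly set) k =
    monomial_ideal V (\<lambda>m. \<forall>W. minimal_cover E W \<longrightarrow> k \<le> weight W m)"
proof -
  let ?I = "edge_ideal V E :: 'k mpoly set"
  note sym = polys.symbolic_power_iff[OF edge_ideal_ideal[unfolded poly_ring_def], folded poly_ring_def,
    unfolded edge_ideal_power_eq[OF Union_edges]]
  show ?thesis
  proof (intro equalityI subsetI)
    fix f assume "f \<in> symbolic_power (poly_ring V) ?I k"
    then have f: "vars f \<subseteq> V" and s: "\<And>P. P \<in> associated_primes (poly_ring V) ?I \<Longrightarrow>
        \<exists>s\<in>{p. vars p \<subseteq> V} - P. s * f \<in> monomial_ideal V (edge_divisible E k)"
      by (auto simp: sym)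
    have "f \<in> monomial_ideal V (\<lambda>m. k \<le> weight W m)" if W: "minimal_cover E W" for W
    proof -
      have fin: "finite W" "vertex_cover E W"
        using W finite_V finite_subset by (auto simp: minimal_cover_iff)
      obtain s where s: "vars s \<subseteq> V" "s \<notin> monomial_ideal V (\<lambda>m. 0 < weight W m)"
        "s * f \<in> monomial_ideal V (edge_divisible E k)"
        using s[OF cover_prime_associated[OF W]] by blast
      have "s * f \<in> monomial_ideal V (\<lambda>m. k \<le> weight W m)"
        using s(3) edge_divisible_le_weight[OF _ fin(2,1)]
        by (blast intro: subsetD[OF monomial_ideal_mono])
      then show ?thesis using s f by (blast intro: weight_ideal_saturated)
    qed
    then show "f \<in> monomial_ideal V (\<lambda>m. \<forall>W. minimal_cover E W \<longrightarrow> k \<le> weight W m)"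
      using f by (auto simp: monomial_ideal_def)
  next
    fix f :: "'k mpoly"
    assume f: "f \<in> monomial_ideal V (\<lambda>m. \<forall>W. minimal_cover E W \<longrightarrow> k \<le> weight W m)"
    have "\<exists>s\<in>{p. vars p \<subseteq> V} - P. s * f \<in> monomial_ideal V (edge_divisible E k)"
      if P: "P \<in> associated_primes (poly_ring V) ?I" for P
    proof -
      have "k \<le> weight {i \<in> V. var i \<in> P} m" if "m \<in> Poly_Mapping.keys f" for m
        using f that associated_prime_minimal_cover[OF P] by (simp add: monomial_ideal_def)
      from associated_prime_multiplier[OF P finite_keys this]
      obtain t where t: "Poly_Mapping.keys t \<subseteq> V" "monom_of t \<notin> P"
        "\<forall>m\<in>Poly_Mapping.keys f. edge_divisible E k (t + m)" by blast
      have "monom_of t * f \<in> monomial_ideal V (edge_divisible E k)"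
      proof (rule mult_in_monomial_ideal)
        show "monom_of t \<in> monomial_ideal V (\<lambda>m. m = t)"
          using t(1) by (simp add: monom_of_in_monomial_ideal)
        show "f \<in> monomial_ideal V (\<lambda>m. m \<in> Poly_Mapping.keys f)"
          using f by (simp add: monomial_ideal_def)
      qed (use t(3) in blast)
      then show ?thesis using t(1,2) by (intro bexI[of _ "monom_of t"]) (auto simp: vars_def)
    qed
    then show "f \<in> symbolic_power (poly_ring V) ?I k"
      using f by (auto simp: sym monomial_ideal_def)
  qed
qed

end


section \<open>Odd cycles\<close>

lemma edge_divisible_mono: "edge_divisible E k m \<Longrightarrow> l \<le> k \<Longrightarrow> edge_divisible E l m"
proof (induction arbitrary: l rule: edge_divisible.induct)
  case (Suc i j k m)
  show ?case
  proof (cases l)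
    case (Suc l')
    then show ?thesis using Suc.IH[of l'] Suc.prems edge_divisible.Suc[OF Suc.hyps(1)] by simp
  qed (simp add: edge_divisible.zero)
qed (simp add: edge_divisible.zero)

lemma edge_divisible_edge_power:
  assumes "{i, j} \<in> E"
  shows "edge_divisible E b (Poly_Mapping.single i b + Poly_Mapping.single j b)"
proof (induction b)
  case (Suc b)
  have "Poly_Mapping.single i (Suc b) + Poly_Mapping.single j (Suc b) =
    Poly_Mapping.single i 1 + Poly_Mapping.single j 1 + (Poly_Mapping.single i b + Poly_Mapping.single j b)"
    by (intro poly_mapping_eqI) (simp add: lookup_add lookup_single when_def)
  then show ?case using edge_divisible.Suc[OF assms Suc] by simp
qed (simp add: edge_divisible.zero)

text \<open>
  Egervary's weighted version of Koenig's theorem for paths. Using the first edge as often as the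
  exponents permit leaves exponent \<open>0\<close> at one of its ends, which can join the cover for free.
\<close>

lemma path_cover_edge_divisible:
  assumes "distinct vs" "successively (\<lambda>x y. {x, y} \<in> E) vs"
  shows "\<exists>W\<subseteq>set vs. successively (\<lambda>x y. x \<in> W \<or> y \<in> W) vs \<and> edge_divisible E (weight W m) m"
  using assms
proof (induction vs arbitrary: m rule: induct_list012)
  case (2 x)
  show ?case by (intro exI[of _ "{}"]) (auto intro: edge_divisible.zero)
next
  case (3 x y zs)
  define b where "b = min (Poly_Mapping.lookup m x) (Poly_Mapping.lookup m y)"
  define e where "e = Poly_Mapping.single x b + Poly_Mapping.single y b"
  define m' where "m' = m - e"
  have xy: "x \<noteq> y" "{x, y} \<in> E" using "3.prems" by auto
  have lookup_e: "Poly_Mapping.lookup e i = (if i = x \<or> i = y then b else 0)" for i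
    using xy(1) by (simp add: e_def lookup_add lookup_single when_def)
  have m: "m = e + m'"
    by (intro poly_mapping_eqI) (simp add: m'_def lookup_add lookup_minus lookup_e b_def)
  obtain W where W: "W \<subseteq> set (y # zs)" "successively (\<lambda>x y. x \<in> W \<or> y \<in> W) (y # zs)"
    "edge_divisible E (weight W m') m'"
    using "3.IH"(2)[of m'] "3.prems" by auto
  have fin: "finite W" using W(1) finite_subset by blast
  have div: "edge_divisible E (b + weight W m') m"
    unfolding m e_def using edge_divisible_mult[OF edge_divisible_edge_power[OF xy(2)] W(3)] .
  have x: "x \<notin> W" "x \<notin> set zs" using W(1) "3.prems" by auto
  have weight_e: "finite U \<Longrightarrow> weight U e = (if x \<in> U then b else 0) + (if y \<in> U then b else 0)" for U
    unfolding e_def weight_add by (simp add: weight_single)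
  \<comment> \<open>In each case \<open>U\<close> contains exactly one end of the first edge, so
    \<open>e\<close> contributes exactly \<open>b\<close>. An end that is newly added is one where
    \<open>m\<close> attains the minimum \<open>b\<close>, hence has exponent 0 in
    \<open>m'\<close>.\<close>
  define U where "U = (if y \<in> W then W else if Poly_Mapping.lookup m y \<le> Poly_Mapping.lookup m x
    then insert y W else insert x W)"
  have "weight U m' = weight W m'"
    using fin x(1) by (auto simp: U_def m'_def lookup_minus lookup_e b_def)
  moreover have "weight U e = b"
    using fin x(1) xy(1) by (auto simp: U_def weight_e)
  ultimately have "weight U m = b + weight W m'" unfolding m weight_add by simp
  moreover have "successively (\<lambda>x y. x \<in> U \<or> y \<in> U) (y # zs)"
    using W(2) by (rule successively_mono) (auto simp: U_def)
  moreover have "x \<in> U \<or> y \<in> U" by (simp add: U_def)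
  moreover have "U \<subseteq> set (x # y # zs)" using W(1) by (auto simp: U_def)
  ultimately show ?case using div by (intro exI[of _ U]) auto
qed (auto intro: edge_divisible.zero)

section \<open>Cutting the cycle open at a missing variable\<close>

lemma successively_upt_iff:
  "successively P [a..<b] \<longleftrightarrow> (\<forall>j. a \<le> j \<and> Suc j < b \<longrightarrow> P j (Suc j))"
proof (induction b)
  case (Suc b)
  show ?case
  proof (cases "a < b")
    case True
    then obtain b' where "b = Suc b'" by (cases b) auto
    then show ?thesis
      using Suc True by (auto simp: successively_append_iff less_Suc_eq)
  qed (auto simp: less_Suc_eq not_less)
qed simp

lemma finite_graph_cycle: "3 \<le> N \<Longrightarrow> finite_graph {1..N} (cycle_edges N)"
  by unfold_locales (auto simp: cycle_edges_def)

text \<open>Deleting \<open>i\<close> leaves a path, with a cover \<open>W\<close> whose weight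
  counts edges dividing \<open>m\<close>. Adding \<open>i\<close> covers the cycle at no extra
  weight, so the bound on minimal covers applies to \<open>W\<close>.\<close>

lemma cycle_edge_divisible:
  assumes N: "3 \<le> N" and i: "i \<in> {1..N}" "Poly_Mapping.lookup m i = 0"
    and k: "\<And>W. minimal_cover (cycle_edges N) W \<Longrightarrow> k \<le> weight W m"
  shows "edge_divisible (cycle_edges N) k m"
proof -
  let ?E = "cycle_edges N"
  \<comment> \<open>The path runs from the successor of \<open>i\<close> up to \<open>N\<close> and
    continues from 1 to the predecessor of \<open>i\<close>.\<close>
  let ?vs = "[Suc i..<Suc N] @ [1..<i]"
  have E: "{j, Suc j} \<in> ?E" if "1 \<le> j" "j < N" for j
    using that by (auto simp: cycle_edges_def)
  have E1: "{N, 1} \<in> ?E" by (simp add: cycle_edges_def)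
  \<comment> \<open>The two segments are joined by the edge from \<open>N\<close> to 1, unless one
    is empty because \<open>i\<close> is 1 or \<open>N\<close>.\<close>
  have starts: "i = 1 \<or> hd [1..<i] = 1"
    using i(1) by (cases "i = 1") (auto simp: hd_upt)
  have ends: "last [Suc i..<Suc N] = N" if "[Suc i..<Suc N] \<noteq> []"
    using that by (simp only: upt_eq_Nil_conv last_upt) simp
  have "successively (\<lambda>x y. {x, y} \<in> ?E) ?vs"
    unfolding successively_append_iff successively_upt_iff
    using i(1) E E1 starts ends by auto
  moreover have "distinct ?vs" by auto
  ultimately obtain W where W: "W \<subseteq> set ?vs" "successively (\<lambda>x y. x \<in> W \<or> y \<in> W) ?vs"
    "edge_divisible ?E (weight W m) m"
    using path_cover_edge_divisible[of ?vs ?E m] by blast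
  have fin: "finite W" using W(1) finite_subset by blast
  have "vertex_cover ?E (insert i W)"
    unfolding vertex_cover_def
  proof
    fix e assume "e \<in> ?E"
    then consider j where "e = {j, Suc j}" "1 \<le> j" "j < N" | "e = {N, 1}"
      by (auto simp: cycle_edges_def)
    then show "e \<inter> insert i W \<noteq> {}"
    proof cases
      case (1 j)
      then show ?thesis
        using W(2) unfolding successively_append_iff successively_upt_iff
        by (cases "j = i \<or> Suc j = i"; cases "i < j") auto
    next
      case 2
      then show ?thesis
        using W(2) i(1) unfolding successively_append_iff
        by (cases "i = N \<or> i = 1") (auto simp: hd_upt last_upt)
    qed
  qed
  then obtain U where U: "U \<subseteq> insert i W" "minimal_cover ?E U"
    using fin by (meson exists_minimal_cover finite_insert)
  have "k \<le> weight U m" using U(2) by (rule k)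
  also have "\<dots> \<le> weight (insert i W) m" using U(1) fin by (intro sum_mono2) auto
  also have "\<dots> = weight W m" using fin i(2) by (simp add: sum.insert_if)
  finally show ?thesis using W(3) edge_divisible_mono by blast
qed

text \<open>The cyclic successor of an uncovered vertex must be covered, so the successor map
  injects the complement of \<open>W\<close> into \<open>W\<close>.\<close>

lemma card_cycle_cover:
  assumes N: "3 \<le> N" and W: "vertex_cover (cycle_edges N) W" "W \<subseteq> {1..N}"
  shows "N \<le> 2 * card W"
proof -
  define s where "s = (\<lambda>j. if j = N then 1 else Suc j)"
  have fin: "finite W" using W(2) finite_subset by blast
  have "inj_on s ({1..N} - W)" by (auto simp: inj_on_def s_def split: if_splits)
  moreover have "s ` ({1..N} - W) \<subseteq> W"
  proof
    fix v assume "v \<in> s ` ({1..N} - W)"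
    then obtain j where j: "j \<in> {1..N}" "j \<notin> W" "v = s j" by blast
    then have "{j, s j} \<in> cycle_edges N" by (auto simp: cycle_edges_def s_def)
    then have "{j, s j} \<inter> W \<noteq> {}" using W(1) unfolding vertex_cover_def by blast
    then show "v \<in> W" using j by auto
  qed
  ultimately have "card ({1..N} - W) \<le> card W" using fin by (rule card_inj_on_le)
  then show ?thesis using W(2) fin by (simp add: card_Diff_subset)
qed

text \<open>Each edge has degree 2; this keeps the product of all variables of the cycle out of the
  ordinary power.\<close>

lemma (in finite_graph) edge_divisible_degree:
  "edge_divisible E k m \<Longrightarrow> 2 * k \<le> weight V m"
proof (induction rule: edge_divisible.induct)
  case (Suc i j k m)
  then show ?case using edgeD[of i j] finite_V by (simp add: weight_add weight_single)
qed simp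

lemma prod_var_eq: "(\<Prod>i\<in>A. var i) = monom_of (\<Sum>i\<in>A. Poly_Mapping.single i 1)"
  by (induction A rule: infinite_finite_induct) (simp_all add: var_def mult_single)

theorem corollary5p4:
  fixes n :: nat
    and S :: "'k::alg_closed_field mpoly ring"
    and I :: "'k mpoly set"
  assumes "n \<ge> 1"
    and "S = poly_ring {1..2 * n + 1}"
    and "I = edge_ideal {1..2 * n + 1} (cycle_edges (2 * n + 1))"
  shows "sdefect S I (n + 1) = 1 \<and>
         symbolic_power S I (n + 1) =
           ideal_power S I (n + 1) <+>\<^bsub>S\<^esub> Idl\<^bsub>S\<^esub> {\<Prod>i\<in>{1..2 * n + 1}. var i}"
proof -
  let ?V = "{1..2 * n + 1}" and ?E = "cycle_edges (2 * n + 1)"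
  let ?x = "\<Prod>i\<in>?V. var i :: 'k mpoly"
  let ?M = "\<lambda>m. \<forall>W. minimal_cover ?E W \<longrightarrow> n + 1 \<le> weight W m"
  have N: "3 \<le> 2 * n + 1" using assms(1) by simp
  interpret G: finite_graph ?V ?E by (rule finite_graph_cycle[OF N])
  interpret S: cring S unfolding assms(2) by (rule cring_poly_ring)
  define c :: "nat \<Rightarrow>\<^sub>0 nat" where "c = (\<Sum>i\<in>?V. Poly_Mapping.single i 1)"
  have x: "?x = monom_of c" unfolding c_def by (rule prod_var_eq)
  have lookup_c: "Poly_Mapping.lookup c i = (if i \<in> ?V then 1 else 0)" for i
    unfolding c_def by (rule lookup_sum_singles) simp
  have keys_c: "Poly_Mapping.keys c = ?V" by (auto simp: in_keys_iff lookup_c split: if_splits)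
  have weight_c: "weight W c = card W" if "W \<subseteq> ?V" for W
    using that by (simp add: lookup_c subset_iff)

  have pow: "ideal_power S I (n + 1) = monomial_ideal ?V (edge_divisible ?E (n + 1))"
    unfolding assms by (rule edge_ideal_power_eq[OF G.Union_edges])
  have sym: "symbolic_power S I (n + 1) = monomial_ideal ?V ?M"
    unfolding assms by (rule G.symbolic_power_edge_ideal)
  have ideal_pow: "ideal (ideal_power S I (n + 1)) S"
    unfolding pow unfolding assms(2) by (rule ideal_edge_divisible)
  have ideal_sym: "ideal (symbolic_power S I (n + 1)) S"
    unfolding sym unfolding assms(2)
    by (rule ideal_monomial_ideal) (auto simp: weight_add intro: trans_le_add2)

  have x_carrier: "?x \<in> carrier S"
    unfolding x assms(2) by (simp add: vars_def keys_c)
  have "?M c"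
  proof (intro allI impI)
    fix W assume W: "minimal_cover ?E W"
    then have "W \<subseteq> ?V" "vertex_cover ?E W" unfolding G.minimal_cover_iff by blast+
    \<comment> \<open>Oddness enters here: \<open>2 * n + 1 \<le> 2 * card W\<close> rounds up to
      \<open>n + 1 \<le> card W\<close>.\<close>
    then show "n + 1 \<le> weight W c"
      using card_cycle_cover[OF N, of W] by (simp add: weight_c)
  qed
  then have x_sym: "?x \<in> symbolic_power S I (n + 1)"
    unfolding sym x monom_of_in_monomial_ideal using keys_c by simp
  \<comment> \<open>The degree \<open>2 * n + 1\<close> is one short of the
    \<open>2 * (n + 1)\<close> required.\<close>
  have x_pow: "?x \<notin> ideal_power S I (n + 1)"
    unfolding pow x monom_of_in_monomial_ideal
    using G.edge_divisible_degree[of "n + 1" c] weight_c[of ?V] by auto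

  have pow_sym: "ideal_power S I (n + 1) \<subseteq> symbolic_power S I (n + 1)"
    unfolding pow sym
  proof (rule monomial_ideal_mono, intro allI impI)
    fix m W assume "edge_divisible ?E (n + 1) m" "minimal_cover ?E W"
    then show "n + 1 \<le> weight W m"
      unfolding G.minimal_cover_iff by (blast intro: edge_divisible_le_weight finite_subset G.finite_V)
  qed
  note ideal_x = S.genideal_ideal[of "{?x}"]
  let ?J = "ideal_power S I (n + 1) <+>\<^bsub>S\<^esub> Idl\<^bsub>S\<^esub> {?x}"
  have ideal_J: "ideal ?J S"
    using x_carrier by (intro S.add_ideals ideal_pow ideal_x) simp
  have zero_pow: "\<zero>\<^bsub>S\<^esub> \<in> ideal_power S I (n + 1)"
    using ideal_pow by (simp add: additive_subgroup.zero_closed ideal.axioms(1))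
  have zero_x: "\<zero>\<^bsub>S\<^esub> \<in> Idl\<^bsub>S\<^esub> {?x}"
    using ideal_x x_carrier by (simp add: additive_subgroup.zero_closed ideal.axioms(1))
  have eq: "symbolic_power S I (n + 1) = ?J"
  proof
    show "symbolic_power S I (n + 1) \<subseteq> ?J"
      unfolding sym
    proof (rule monomial_ideal_subset)
      show "ideal ?J (poly_ring ?V)" using ideal_J unfolding assms(2) .
      fix m assume m: "Poly_Mapping.keys m \<subseteq> ?V" "?M m"
      show "monom_of m \<in> ?J"
      proof (cases "\<exists>i\<in>?V. Poly_Mapping.lookup m i = 0")
        case True
        then have "edge_divisible ?E (n + 1) m"
          using cycle_edge_divisible[OF N] m(2) by blast
        then have "monom_of m \<in> ideal_power S I (n + 1)"
          unfolding pow monom_of_in_monomial_ideal using m(1) by simp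
        moreover have "monom_of m = monom_of m \<oplus>\<^bsub>S\<^esub> \<zero>\<^bsub>S\<^esub>"
          by (simp add: assms(2) poly_ring_def)
        ultimately show ?thesis using zero_x unfolding set_add_def' by blast
      next
        case False
        \<comment> \<open>All exponents are positive, so the truncated subtraction is exact and
          \<open>m\<close> is divisible by the product of all variables.\<close>
        then have "m = (m - c) + c"
          by (intro poly_mapping_eqI) (auto simp: lookup_add lookup_minus lookup_c Suc_le_eq)
        then have "(monom_of m :: 'k mpoly) = monom_of (m - c) * ?x"
          unfolding x by (metis monom_of_add)
        moreover have "monom_of (m - c) \<in> carrier S"
          using m(1) by (auto simp: assms(2) vars_def in_keys_iff lookup_minus)
        moreover have "?x \<in> Idl\<^bsub>S\<^esub> {?x}"
          using S.genideal_self'[OF x_carrier] .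
        ultimately have "monom_of m \<in> Idl\<^bsub>S\<^esub> {?x}"
          using ideal.I_l_closed[OF ideal_x] x_carrier by (simp add: assms(2))
        moreover have "monom_of m = \<zero>\<^bsub>S\<^esub> \<oplus>\<^bsub>S\<^esub> monom_of m"
          by (simp add: assms(2) poly_ring_def)
        ultimately show ?thesis using zero_pow unfolding set_add_def' by blast
      qed
    qed
    have "Idl\<^bsub>S\<^esub> {?x} \<subseteq> symbolic_power S I (n + 1)"
      using x_sym by (intro S.genideal_minimal[OF ideal_sym]) simp
    then show "?J \<subseteq> symbolic_power S I (n + 1)"
      using pow_sym additive_subgroup.a_closed[OF ideal.axioms(1)[OF ideal_sym]]
      unfolding set_add_def' by blast
  qed
  have "sdefect S I (n + 1) = 1"
    unfolding sdefect_def
  proof (rule Least_equality)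
    show "\<exists>Fs. length Fs = 1 \<and> set Fs \<subseteq> carrier S \<and>
        symbolic_power S I (n + 1) = ideal_power S I (n + 1) <+>\<^bsub>S\<^esub> Idl\<^bsub>S\<^esub> (set Fs)"
      using eq x_carrier by (intro exI[of _ "[?x]"]) simp
    fix \<mu>
    assume "\<exists>Fs. length Fs = \<mu> \<and> set Fs \<subseteq> carrier S \<and>
        symbolic_power S I (n + 1) = ideal_power S I (n + 1) <+>\<^bsub>S\<^esub> Idl\<^bsub>S\<^esub> (set Fs)"
    then obtain Fs where Fs: "length Fs = \<mu>"
      "symbolic_power S I (n + 1) = ideal_power S I (n + 1) <+>\<^bsub>S\<^esub> Idl\<^bsub>S\<^esub> (set Fs)" by blast
    \<comment> \<open>Without generators the two powers would coincide, but \<open>?x\<close>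
      separates them.\<close>
    have "\<mu> \<noteq> 0"
    proof
      assume "\<mu> = 0"
      then have "?x \<in> ideal_power S I (n + 1) <+>\<^bsub>S\<^esub> Idl\<^bsub>S\<^esub> {}"
        using Fs x_sym by simp
      moreover have "Idl\<^bsub>S\<^esub> {} \<subseteq> {\<zero>\<^bsub>S\<^esub>}"
        by (rule S.genideal_minimal[OF S.zeroideal]) simp
      ultimately obtain y where "y \<in> ideal_power S I (n + 1)" "?x = y \<oplus>\<^bsub>S\<^esub> \<zero>\<^bsub>S\<^esub>"
        unfolding set_add_def' by blast
      then show False using x_pow by (simp add: assms(2) poly_ring_def)
    qed
    then show "1 \<le> \<mu>" by simp
  qed
  then show ?thesis using eq by blast
qed

end
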